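(* Let $\langle \mathcal{T}, n, \mathcal{C}\rangle$ be a simple architecture diagram. There exists an architecture conforming to $\langle \mathcal{T}, n, \mathcal{C}\rangle$ if and only if, for each connector motif $\Gamma = (a, \{m_p:d_p\}_{p\in a}) \in \mathcal{C}$ and each $p \in a$, the following three conditions hold, where $s_p = n_p\cdot d_p/m_p$: 1) $m_p \le n_p$; 2) for all $q \in a$, $s_p = s_q \in \mathbb{N}$; 3) $s_p \le \prod_{q\in a} \binom{n_q}{m_q}$.
   Context: A component type $T$ has a set of generic ports $T.P$ (distinct types have disjoint sets of generic ports). A simple architecture diagram $\langle \mathcal{T}, n, \mathcal{C}\rangle$ consists of: a set of component types $\mathcal{T}=\{T_1,\dots,T_k\}$; a cardinality function $n$ assigning to each $T_i$ a positive integer $n_i = n(T_i)$; a set of connector motifs $\mathcal{C}=\{\Gamma_1,\dots,\Gamma_l\}$ of the form $\Gamma=(a,\{m_p:d_p\}_{p\in a})$, where $\emptyset\ne a\subseteq\bigcup_{i=1}^k T_i.P$ and $m_p, d_p$ are positive integers, called the multiplicity and the degree of $p$ in $\Gamma$. Standing assumption: for any two distinct connector motifs $(a,\{m_p^i:d_p^i\}_{p\in a})$, $i=1,2$, with the same set $a$, there is $p\in a$ with $m_p^1\neq m_p^2$. For $p\in T.P$ with $T \in \mathcal{T}$, write $n_p=n(T)$. An architecture is a pair $\langle\mathcal{B},\gamma\rangle$, where $\mathcal{B}$ is a set of components (each with a set of ports) and $\gamma$ is a configuration, i.e. a set of connectors; a connector is a set of ports of components in $\mathcal{B}$. A component $B$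 is of type $T$ if its ports are in bijective correspondence with the generic ports of $T$. If $B_1,\dots,B_N$ are all the components of type $T$ in $\mathcal{B}$ and $p\in T.P$, the corresponding ports $p_1,\dots,p_N$ of $B_1,\dots,B_N$ are called the instances of $p$. An architecture $\langle\mathcal{B},\gamma\rangle$ conforms to $\langle\mathcal{T},n,\mathcal{C}\rangle$ if, for each $i\in[1,k]$, the number of components of type $T_i$ in $\mathcal{B}$ equals $n_i$, and $\gamma$ can be partitioned into disjoint sets $\gamma_1,\dots,\gamma_l$ such that, for each motif $\Gamma_j=(a,\{m_p:d_p\}_{p\in a})\in\mathcal{C}$, every connector in $\gamma_j$ consists only of instances of generic ports in $a$, and for each $p\in a$: 1) each connector in $\gamma_j$ contains exactly $m_p$ instances of $p$; 2) each instance of $p$ belongs to exactly $d_p$ connectors in $\gamma_j$. *)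

theory Defs
  imports Complex_Main "HOL-Library.Disjoint_Sets"
begin

text \<open>A connector motif \<open>(a, {m\<^sub>p : d\<^sub>p})\<close>. The functions \<open>mult\<close> and \<open>deg\<close> are meaningful on
  \<open>a = support\<close> only. Two records of a diagram never represent the same motif: if they agreed on
  \<open>a\<close> but differed outside of it, they would violate the last condition of \<open>simple_diagram\<close>.\<close>

record 'p motif =
  support :: "'p set"
  mult :: "'p \<Rightarrow> nat"
  deg :: "'p \<Rightarrow> nat"

record ('t, 'p) diagram =
  types :: "'t set"
  gports :: "'t \<Rightarrow> 'p set"
  cardinality :: "'t \<Rightarrow> nat"
  motifs :: "'p motif set"

text \<open>Finiteness of \<open>support \<Gamma>\<close> makes the product over \<open>a\<close> a genuine finite product; the sets
  of generic ports themselves may be infinite.\<close>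

definition simple_diagram :: "('t, 'p) diagram \<Rightarrow> bool" where
  "simple_diagram D \<longleftrightarrow>
     finite (types D) \<and>
     disjoint_family_on (gports D) (types D) \<and>
     (\<forall>t\<in>types D. cardinality D t > 0) \<and>
     finite (motifs D) \<and>
     (\<forall>\<Gamma>\<in>motifs D.
        support \<Gamma> \<noteq> {} \<and> finite (support \<Gamma>) \<and>
        support \<Gamma> \<subseteq> (\<Union>t\<in>types D. gports D t) \<and>
        (\<forall>p\<in>support \<Gamma>. mult \<Gamma> p > 0 \<and> deg \<Gamma> p > 0)) \<and>
     (\<forall>\<Gamma>1\<in>motifs D. \<forall>\<Gamma>2\<in>motifs D.
        \<Gamma>1 \<noteq> \<Gamma>2 \<and> support \<Gamma>1 = support \<Gamma>2 \<longrightarrow>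
        (\<exists>p\<in>support \<Gamma>1. mult \<Gamma>1 p \<noteq> mult \<Gamma>2 p))"

text \<open>\<open>n\<^sub>p = n(T)\<close> for the unique type \<open>T\<close> of the diagram with \<open>p \<in> T.P\<close>.\<close>

definition port_card :: "('t, 'p) diagram \<Rightarrow> 'p \<Rightarrow> nat" where
  "port_card D p = cardinality D (THE t. t \<in> types D \<and> p \<in> gports D t)"

record ('c, 'q) architecture =
  comps :: "'c set"
  ports :: "'c \<Rightarrow> 'q set"
  config :: "'q set set"

text \<open>Each port belongs to a single component.\<close>

definition wf_architecture :: "('c, 'q) architecture \<Rightarrow> bool" where
  "wf_architecture A \<longleftrightarrow>
     disjoint_family_on (ports A) (comps A) \<and>
     (\<forall>k\<in>config A. k \<subseteq> (\<Union>c\<in>comps A. ports A c))"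

definition comps_of_type :: "('c, 'q) architecture \<Rightarrow> ('c \<Rightarrow> 't option) \<Rightarrow> 't \<Rightarrow> 'c set" where
  "comps_of_type A ty t = {c \<in> comps A. ty c = Some t}"

text \<open>A typing consists of the component types \<open>ty\<close> and the bijections \<open>inst c\<close> from generic ports
  to the ports of \<open>c\<close>. The value \<open>None\<close> is for components whose type is not in the
  diagram, which conformance does not forbid.\<close>

definition typing ::
  "('t, 'p) diagram \<Rightarrow> ('c, 'q) architecture \<Rightarrow> ('c \<Rightarrow> 't option) \<Rightarrow> ('c \<Rightarrow> 'p \<Rightarrow> 'q) \<Rightarrow> bool" where
  "typing D A ty inst \<longleftrightarrow>
     (\<forall>t\<in>types D. \<forall>c\<in>comps_of_type A ty t. bij_betw (inst c) (gports D t) (ports A c))"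

definition instances ::
  "('t, 'p) diagram \<Rightarrow> ('c, 'q) architecture \<Rightarrow> ('c \<Rightarrow> 't option) \<Rightarrow> ('c \<Rightarrow> 'p \<Rightarrow> 'q) \<Rightarrow>
   'p \<Rightarrow> 'q set" where
  "instances D A ty inst p =
     {inst c p | c t. t \<in> types D \<and> p \<in> gports D t \<and> c \<in> comps_of_type A ty t}"

text \<open>Every number prescribed through \<open>card\<close> below is positive in a simple diagram, so the sets
  concerned are automatically finite.\<close>

definition realises_motif :: "'p motif \<Rightarrow> ('p \<Rightarrow> 'q set) \<Rightarrow> 'q set set \<Rightarrow> bool" where
  "realises_motif \<Gamma> I G \<longleftrightarrow>
     (\<forall>k\<in>G. k \<subseteq> (\<Union>p\<in>support \<Gamma>. I p)) \<and>
     (\<forall>p\<in>support \<Gamma>.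
        (\<forall>k\<in>G. card (k \<inter> I p) = mult \<Gamma> p) \<and>
        (\<forall>x\<in>I p. card {k \<in> G. x \<in> k} = deg \<Gamma> p))"

definition conforms :: "('c, 'q) architecture \<Rightarrow> ('t, 'p) diagram \<Rightarrow> bool" where
  "conforms A D \<longleftrightarrow>
     (\<exists>ty inst. typing D A ty inst \<and>
        (\<forall>t\<in>types D. card (comps_of_type A ty t) = cardinality D t) \<and>
        (\<exists>part. (\<Union>\<Gamma>\<in>motifs D. part \<Gamma>) = config A \<and>
           disjoint_family_on part (motifs D) \<and>
           (\<forall>\<Gamma>\<in>motifs D. realises_motif \<Gamma> (instances D A ty inst) (part \<Gamma>))))"

text \<open>\<open>s\<^sub>p = n\<^sub>p d\<^sub>p / m\<^sub>p\<close>, a priori only a rational number.\<close>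

definition matching_factor :: "('t, 'p) diagram \<Rightarrow> 'p motif \<Rightarrow> 'p \<Rightarrow> rat" where
  "matching_factor D \<Gamma> p = of_nat (port_card D p) * of_nat (deg \<Gamma> p) / of_nat (mult \<Gamma> p)"

end

theory Submission imports Defs begin

text \<open>A conforming architecture yields the three conditions by double counting incidences between
  connectors and port instances. Conversely, for each motif start from any \<open>s\<close> connectors with the
  prescribed multiplicities. If some instance \<open>x\<close> of \<open>p\<close> lies in more than \<open>d\<^sub>p\<close> of them, another
  instance \<open>y\<close> lies in fewer, so exchanging \<open>x\<close> for \<open>y\<close> in a suitable connector gives a
  connector not yet chosen; this decreases the total excess of the degrees. Families chosen for
  different motifs are disjoint because a connector determines the support and the
  multiplicities of its motif.\<close>

section \<open>Counting connectors with prescribed multiplicities\<close>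

definition connectors :: "'p set \<Rightarrow> ('p \<Rightarrow> 'q set) \<Rightarrow> ('p \<Rightarrow> nat) \<Rightarrow> 'q set set" where
  "connectors a I m = {k. k \<subseteq> (\<Union>p\<in>a. I p) \<and> (\<forall>p\<in>a. card (k \<inter> I p) = m p)}"

lemma finite_connectors:
  assumes "finite a" "\<forall>p\<in>a. finite (I p)"
  shows "finite (connectors a I m)"
proof (rule finite_subset)
  show "connectors a I m \<subseteq> Pow (\<Union>p\<in>a. I p)" by (auto simp: connectors_def)
  show "finite (Pow (\<Union>p\<in>a. I p))" using assms by auto
qed

text \<open>A connector is determined by its traces on the pairwise disjoint sets
  \<open>I p\<close>, and these traces can be chosen independently, each as any subset of
  \<open>I p\<close> of size \<open>m p\<close>.\<close>

lemma card_connectors: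
  assumes "finite a" "\<forall>p\<in>a. finite (I p)" "disjoint_family_on I a"
  shows "card (connectors a I m) = (\<Prod>p\<in>a. card (I p) choose m p)"
proof -
  let ?P = "PiE a (\<lambda>p. {S. S \<subseteq> I p \<and> card S = m p})"
  \<comment> \<open>By disjointness of the instance sets, gluing a choice \<open>g\<close> loses
    nothing: the trace on \<open>I p\<close> gives \<open>g p\<close> back. This makes union and
    traces mutually inverse.\<close>
  have inter: "(\<Union>q\<in>a. g q) \<inter> I p = g p" if "g \<in> ?P" "p \<in> a" for g p
  proof -
    have "g q \<inter> I p = {}" if "q \<in> a" "q \<noteq> p" for q
      using disjoint_family_onD[OF assms(3) \<open>q \<in> a\<close> \<open>p \<in> a\<close>] that \<open>g \<in> ?P\<close> by (auto simp: PiE_iff)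
    then show ?thesis using that by (auto simp: PiE_iff)
  qed
  have "bij_betw (\<lambda>k. \<lambda>p\<in>a. k \<inter> I p) (connectors a I m) ?P"
  proof (rule bij_betw_byWitness[where f' = "\<lambda>g. \<Union>p\<in>a. g p"])
    show "\<forall>k\<in>connectors a I m. (\<Union>p\<in>a. (\<lambda>p\<in>a. k \<inter> I p) p) = k"
      by (auto simp: connectors_def)
    show "\<forall>g\<in>?P. (\<lambda>p\<in>a. (\<Union>p\<in>a. g p) \<inter> I p) = g"
    proof
      fix g assume g: "g \<in> ?P"
      show "(\<lambda>p\<in>a. (\<Union>p\<in>a. g p) \<inter> I p) = g"
      proof
        fix p show "(\<lambda>p\<in>a. (\<Union>p\<in>a. g p) \<inter> I p) p = g p"
          using inter[OF g, of p] g by (cases "p \<in> a") (auto simp: PiE_iff extensional_def)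
      qed
    qed
    show "(\<lambda>k. \<lambda>p\<in>a. k \<inter> I p) ` connectors a I m \<subseteq> ?P"
      by (auto simp: connectors_def)
    show "(\<lambda>g. \<Union>p\<in>a. g p) ` ?P \<subseteq> connectors a I m"
    proof (safe)
      fix g assume g: "g \<in> ?P"
      have "(\<Union>p\<in>a. g p) \<subseteq> (\<Union>p\<in>a. I p)" using g by (fastforce simp: PiE_iff)
      moreover have "card ((\<Union>p\<in>a. g p) \<inter> I p) = m p" if "p \<in> a" for p
        using inter[OF g that] g that by (auto simp: PiE_iff)
      ultimately show "(\<Union>p\<in>a. g p) \<in> connectors a I m" by (simp add: connectors_def)
    qed
  qed
  then have "card (connectors a I m) = card ?P" by (rule bij_betw_same_card)
  also have "\<dots> = (\<Prod>p\<in>a. card (I p) choose m p)"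
    using assms by (simp add: card_PiE n_subsets)
  finally show ?thesis .
qed

text \<open>Double counting of the incidences between the instances of \<open>p\<close> and the
  connectors in \<open>G\<close>.\<close>

lemma sum_degrees_connectors:
  assumes "finite G" "G \<subseteq> connectors a I m" "p \<in> a" "finite (I p)"
  shows "(\<Sum>x\<in>I p. card {k \<in> G. x \<in> k}) = card G * m p"
proof -
  have "(\<Sum>x\<in>I p. card {k \<in> G. x \<in> k}) = (\<Sum>k\<in>G. m p)"
  proof (rule sum_multicount_gen)
    show "\<forall>k\<in>G. card {x \<in> I p. x \<in> k} = m p"
      using assms by (auto simp: connectors_def Int_def conj_commute dest!: subsetD)
  qed (use assms in auto)
  then show ?thesis by simp
qed

section \<open>Regular families of connectors by exchange\<close>

lemma connectors_exchange:
  assumes fin: "\<forall>p\<in>a. finite (I p)" and dis: "disjoint_family_on I a"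
    and k: "k \<in> connectors a I m"
    and p: "p \<in> a" and x: "x \<in> I p" "x \<in> k" and y: "y \<in> I p" "y \<notin> k"
  shows "insert y (k - {x}) \<in> connectors a I m"
proof -
  have "card (insert y (k - {x}) \<inter> I q) = m q" if q: "q \<in> a" for q
  proof (cases "q = p")
    case True
    have "insert y (k - {x}) \<inter> I q = insert y (k \<inter> I q - {x})" using True y by auto
    moreover have "card (insert y (k \<inter> I q - {x})) = card (k \<inter> I q)"
      using True x y fin q by (subst card_insert_disjoint) (auto simp: card_Suc_Diff1 simp del: card_Diff_insert card_Diff_singleton)
    ultimately show ?thesis using k q by (auto simp: connectors_def)
  next
    case False
    then have "I q \<inter> I p = {}" using disjoint_family_onD[OF dis q p] by auto
    then have "insert y (k - {x}) \<inter> I q = k \<inter> I q" using x y by auto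
    then show ?thesis using k q by (auto simp: connectors_def)
  qed
  then show ?thesis using k p y by (auto simp: connectors_def)
qed

text \<open>The replacement of \<open>k\<close> is not already in \<open>G\<close>, so no two
  connectors collapse into one. It differs from \<open>k\<close> only in \<open>x\<close> and
  \<open>y\<close>, hence no other degree changes.\<close>

lemma degree_exchange:
  assumes "finite G" "k \<in> G" "x \<in> k" "y \<notin> k" "insert y (k - {x}) \<notin> G"
    and "H = insert (insert y (k - {x})) (G - {k})"
  shows "card H = card G"
    and "card {e \<in> H. x \<in> e} < card {e \<in> G. x \<in> e}"
    and "card {e \<in> H. y \<in> e} = Suc (card {e \<in> G. y \<in> e})"
    and "z \<noteq> x \<Longrightarrow> z \<noteq> y \<Longrightarrow> card {e \<in> H. z \<in> e} = card {e \<in> G. z \<in> e}"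
proof -
  define l where "l = insert y (k - {x})"
  have l: "l \<notin> G" "l \<noteq> k" "x \<notin> l" "y \<in> l" and H: "H = insert l (G - {k})"
    using assms by (auto simp: l_def)
  have z_iff: "z \<in> l \<longleftrightarrow> z \<in> k" if "z \<noteq> x" "z \<noteq> y"
    using that by (simp add: l_def)
  note diff = card_Diff_insert card_Diff_singleton
  show "card H = card G"
    using assms(1,2) l(1) by (simp add: H card_Suc_Diff1 del: diff)
  have "{e \<in> H. x \<in> e} = {e \<in> G. x \<in> e} - {k}" using l(3) by (auto simp: H)
  then show "card {e \<in> H. x \<in> e} < card {e \<in> G. x \<in> e}"
    using assms(1-3) by (simp add: card_Diff1_less del: diff)
  have "{e \<in> H. y \<in> e} = insert l {e \<in> G. y \<in> e}" using l(4) assms(4) by (auto simp: H)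
  then show "card {e \<in> H. y \<in> e} = Suc (card {e \<in> G. y \<in> e})"
    using assms(1) l(1) by simp
  assume z: "z \<noteq> x" "z \<noteq> y"
  show "card {e \<in> H. z \<in> e} = card {e \<in> G. z \<in> e}"
  proof (cases "z \<in> k")
    case True
    then have "{e \<in> H. z \<in> e} = insert l ({e \<in> G. z \<in> e} - {k})" using z_iff[OF z] by (auto simp: H)
    then show ?thesis using True assms(1,2) l(1) by (simp add: card_Suc_Diff1 del: diff)
  next
    case False
    then have "{e \<in> H. z \<in> e} = {e \<in> G. z \<in> e}" using z_iff[OF z] by (auto simp: H)
    then show ?thesis by simp
  qed
qed

text \<open>Extremal argument: among the families of \<open>s\<close> connectors one of least excess
  is taken. An overfull instance would allow an exchange lowering the excess, and without overfull
  instances the degree sums force equality everywhere.\<close>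

lemma ex_regular_connectors:
  assumes a: "finite a" and fin: "\<forall>p\<in>a. finite (I p)" and dis: "disjoint_family_on I a"
    and s: "\<forall>p\<in>a. s * m p = card (I p) * d p"
    and le: "s \<le> (\<Prod>p\<in>a. card (I p) choose m p)"
  shows "\<exists>G\<subseteq>connectors a I m. card G = s \<and> (\<forall>p\<in>a. \<forall>x\<in>I p. card {k \<in> G. x \<in> k} = d p)"
proof -
  let ?F = "connectors a I m"
  define V where "V = (SIGMA p:a. I p)"
  define deg where "deg G x = card {k \<in> G. x \<in> k}" for G :: "'b set set" and x
  \<comment> \<open>Truncated subtraction counts only the instances above their target degree;
    deficits contribute 0. Each instance is paired with its generic port because the target
    \<open>d p\<close> depends on that port.\<close>
  define excess where "excess G = (\<Sum>(p, x)\<in>V. deg G x - d p)" for G :: "'b set set"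
  have finF: "finite ?F" using finite_connectors[OF a fin] .
  have finV: "finite V" using a fin by (simp add: V_def)
  let ?ok = "\<lambda>G. G \<subseteq> ?F \<and> card G = s"
  \<comment> \<open>The bound on \<open>s\<close> says exactly that there are enough connectors for
    an initial family.\<close>
  obtain G0 where "?ok G0"
    using le card_connectors[OF a fin dis, of m] by (metis obtain_subset_with_card_n)
  then obtain G where G: "G \<subseteq> ?F" "card G = s"
    and min: "\<And>H. H \<subseteq> ?F \<Longrightarrow> card H = s \<Longrightarrow> excess G \<le> excess H"
    using ex_has_least_nat[of ?ok G0 excess] by auto
  have finG: "finite G" using G finF finite_subset by blast
  \<comment> \<open>Whatever the choice of \<open>G\<close>, the average degree over
    \<open>I p\<close> is already \<open>d p\<close>; an overfull instance is therefore compensated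
    by a deficient one.\<close>
  have total: "(\<Sum>x\<in>I p. deg G x) = (\<Sum>x\<in>I p. d p)" if "p \<in> a" for p
    using sum_degrees_connectors[OF finG G(1) that] fin that s G by (simp add: deg_def)
  have upper: "deg G x \<le> d p" if p: "p \<in> a" and x: "x \<in> I p" for p x
  proof (rule ccontr)
    assume "\<not> deg G x \<le> d p"
    then have gt: "d p < deg G x" by simp
    obtain y where y: "y \<in> I p" "deg G y < d p"
    proof (rule ccontr)
      assume "\<not> thesis"
      then have "\<forall>y\<in>I p. d p \<le> deg G y" using that by force
      then have "(\<Sum>x\<in>I p. d p) < (\<Sum>x\<in>I p. deg G x)"
        using fin p x gt by (intro sum_strict_mono_ex1) auto
      then show False using total[OF p] by simp
    qed
    \<comment> \<open>Connectors containing both \<open>x\<close> and \<open>y\<close> cancel when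
      the two degrees are compared, so \<open>?X\<close> is strictly larger than
      \<open>?Y\<close>.\<close>
    let ?X = "{k \<in> G. x \<in> k \<and> y \<notin> k}" and ?Y = "{k \<in> G. y \<in> k \<and> x \<notin> k}"
    let ?B = "{k \<in> G. x \<in> k \<and> y \<in> k}"
    have "deg G x = card ?X + card ?B"
      unfolding deg_def using finG by (subst card_Un_disjoint[symmetric]) (auto intro: arg_cong[where f=card])
    moreover have "deg G y = card ?Y + card ?B"
      unfolding deg_def using finG by (subst card_Un_disjoint[symmetric]) (auto intro: arg_cong[where f=card])
    ultimately have less: "card ?Y < card ?X" using gt y by simp
    \<comment> \<open>Every member of \<open>?X\<close> contains \<open>x\<close> and omits
      \<open>y\<close>, so the exchange can be undone.\<close>
    have inj: "inj_on (\<lambda>k. insert y (k - {x})) ?X"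
    proof (rule inj_onI)
      fix k l assume "k \<in> ?X" "l \<in> ?X" "insert y (k - {x}) = insert y (l - {x})"
      then show "k = l" by (auto simp: set_eq_iff)
    qed
    have "\<not> (\<lambda>k. insert y (k - {x})) ` ?X \<subseteq> ?Y"
      using card_mono[of ?Y "(\<lambda>k. insert y (k - {x})) ` ?X"] less finG by (auto simp: card_image[OF inj])
    then obtain k where k: "k \<in> ?X" "insert y (k - {x}) \<notin> ?Y" by blast
    \<comment> \<open>The exchanged connector contains \<open>y\<close> and not \<open>x\<close>;
      being outside \<open>?Y\<close>, it is outside \<open>G\<close>.\<close>
    have kG: "k \<in> G" "x \<in> k" "y \<notin> k" "insert y (k - {x}) \<notin> G" using k by auto
    define H where "H = insert (insert y (k - {x})) (G - {k})"
    note ex = degree_exchange[OF finG kG H_def, folded deg_def]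
    have "insert y (k - {x}) \<in> ?F"
      using connectors_exchange[OF fin dis _ p x kG(2) y(1) kG(3)] kG G by blast
    then have "H \<subseteq> ?F" using G by (auto simp: H_def)
    moreover have "card H = s" using ex(1) G by simp
    moreover have "excess H < excess G"
      unfolding excess_def
    proof (rule sum_strict_mono_ex1[OF finV])
      have uniq: "q = p" if "q \<in> a" "z \<in> I q" "z \<in> I p" for q z
        using disjoint_family_onD[OF dis \<open>q \<in> a\<close> p] that by blast
      show "\<forall>v\<in>V. (case v of (q, z) \<Rightarrow> deg H z - d q) \<le> (case v of (q, z) \<Rightarrow> deg G z - d q)"
      proof safe
        fix q z assume "(q, z) \<in> V"
        then have q: "q \<in> a" "z \<in> I q" by (auto simp: V_def)
        consider "z = x" | "z = y" | "z \<noteq> x" "z \<noteq> y" by blast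
        then show "deg H z - d q \<le> deg G z - d q"
        proof cases
          case 1
          then show ?thesis using ex(2) by simp
        next
          \<comment> \<open>As \<open>y\<close> had degree below \<open>d p\<close>, its new degree
            is at most \<open>d p\<close>: the truncated excess at \<open>y\<close> is 0 before and
            after.\<close>
          case 2
          then have "q = p" using uniq q y by blast
          then show ?thesis using 2 ex(3) y by simp
        qed (use ex(4) in simp)
      qed
      \<comment> \<open>Strictness comes from \<open>x\<close>, whose excess was positive and
        therefore not truncated.\<close>
      show "\<exists>v\<in>V. (case v of (q, z) \<Rightarrow> deg H z - d q) < (case v of (q, z) \<Rightarrow> deg G z - d q)"
        using p x ex(2) gt by (intro bexI[of _ "(p, x)"]) (auto simp: V_def)
    qed
    ultimately show False using min[of H] by simp
  qed
  have "deg G x = d p" if "p \<in> a" "x \<in> I p" for p x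
  proof (rule ccontr)
    assume "deg G x \<noteq> d p"
    then have "deg G x < d p" using upper[OF that] by simp
    then have "(\<Sum>x\<in>I p. deg G x) < (\<Sum>x\<in>I p. d p)"
      using upper that fin by (intro sum_strict_mono_ex1) auto
    then show False using total that by simp
  qed
  then show ?thesis using G by (auto simp: deg_def)
qed

section \<open>Motifs and port instances in a typed architecture\<close>

lemma realises_motif_iff_connectors:
  "realises_motif \<Gamma> I G \<longleftrightarrow> G \<subseteq> connectors (support \<Gamma>) I (mult \<Gamma>) \<and>
     (\<forall>p\<in>support \<Gamma>. \<forall>x\<in>I p. card {k \<in> G. x \<in> k} = deg \<Gamma> p)"
  unfolding realises_motif_def connectors_def by blast

lemma port_card_eq:
  assumes "disjoint_family_on (gports D) (types D)" "t \<in> types D" "p \<in> gports D t"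
  shows "port_card D p = cardinality D t"
proof -
  have "(THE t. t \<in> types D \<and> p \<in> gports D t) = t"
    using assms by (intro the_equality) (auto simp: disjoint_family_on_def)
  then show ?thesis by (simp add: port_card_def)
qed

text \<open>The typing and the component counts are separated from the partition of the
  configuration. This serves both directions: analysing a given conforming architecture, and
  choosing connectors for components already built.\<close>

locale typed_architecture =
  fixes D :: "('t, 'p) diagram" and A :: "('c, 'q) architecture"
    and ty :: "'c \<Rightarrow> 't option" and inst :: "'c \<Rightarrow> 'p \<Rightarrow> 'q"
  assumes simple: "simple_diagram D"
    and disjoint_ports: "disjoint_family_on (ports A) (comps A)"
    and typing: "typing D A ty inst"
    and card_comps: "\<forall>t\<in>types D. card (comps_of_type A ty t) = cardinality D t"
begin

abbreviation "I \<equiv> instances D A ty inst"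

lemma instances_eq:
  assumes "t \<in> types D" "p \<in> gports D t"
  shows "I p = (\<lambda>c. inst c p) ` comps_of_type A ty t"
proof -
  have "t' = t" if "t' \<in> types D" "p \<in> gports D t'" for t'
    using that assms simple unfolding simple_diagram_def disjoint_family_on_def by blast
  then show ?thesis using assms unfolding instances_def by blast
qed

lemma inst_in_ports:
  assumes "t \<in> types D" "p \<in> gports D t" "c \<in> comps_of_type A ty t"
  shows "inst c p \<in> ports A c" "c \<in> comps A"
proof -
  have "bij_betw (inst c) (gports D t) (ports A c)" using assms typing by (simp add: typing_def)
  then show "inst c p \<in> ports A c" using assms(2) by (rule bij_betw_apply)
  show "c \<in> comps A" using assms(3) by (simp add: comps_of_type_def)
qed

text \<open>A port lies in a single component, that component has a single type, and
  \<open>inst c\<close> is injective on the generic ports of this type.\<close>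

lemma inst_eqD:
  assumes "t \<in> types D" "p \<in> gports D t" "c \<in> comps_of_type A ty t"
    and "t' \<in> types D" "p' \<in> gports D t'" "c' \<in> comps_of_type A ty t'"
    and "inst c p = inst c' p'"
  shows "c = c' \<and> p = p'"
proof -
  have c: "c = c'"
    using inst_in_ports[OF assms(1-3)] inst_in_ports[OF assms(4-6)] assms(7) disjoint_ports
    by (auto simp: disjoint_family_on_def)
  then have "t = t'" using assms by (auto simp: comps_of_type_def)
  moreover have "inj_on (inst c) (gports D t)"
    using typing assms by (auto simp: typing_def bij_betw_def)
  ultimately show ?thesis using c assms by (auto dest: inj_onD)
qed

lemma instances_subset_ports: "I p \<subseteq> (\<Union>c\<in>comps A. ports A c)"
  by (auto simp: instances_def intro!: bexI inst_in_ports)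

lemma disjoint_instances: "p \<noteq> q \<Longrightarrow> I p \<inter> I q = {}"
  by (auto simp: instances_def dest: inst_eqD)

lemma instances_card:
  assumes "\<Gamma> \<in> motifs D" "p \<in> support \<Gamma>"
  shows "card (I p) = port_card D p" "port_card D p > 0" "finite (I p)"
proof -
  obtain t where t: "t \<in> types D" "p \<in> gports D t"
    using simple assms by (fastforce simp: simple_diagram_def)
  have "inj_on (\<lambda>c. inst c p) (comps_of_type A ty t)"
    using inst_eqD[OF t _ t] by (auto intro: inj_onI)
  then have "card (I p) = cardinality D t"
    using card_comps t by (simp add: instances_eq[OF t] card_image)
  moreover have pc: "port_card D p = cardinality D t"
    using simple t by (intro port_card_eq) (auto simp: simple_diagram_def)
  ultimately show "card (I p) = port_card D p" by simp
  show "port_card D p > 0" using pc simple t by (auto simp: simple_diagram_def)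
  \<comment> \<open>Infinite sets have \<open>card\<close> 0, so a positive cardinality gives
    finiteness.\<close>
  then show "finite (I p)" using \<open>card (I p) = port_card D p\<close> card_ge_0_finite by metis
qed

text \<open>Double counting gives \<open>n_p * d_p = card G * m_p\<close>. Thus \<open>s_p\<close>
  is the number of connectors realising the motif, a natural number independent of \<open>p\<close>
  and bounded by the number of all admissible connectors.\<close>

lemma realises_motif_conditions:
  assumes \<Gamma>: "\<Gamma> \<in> motifs D" and G: "realises_motif \<Gamma> I G" and p: "p \<in> support \<Gamma>"
  shows "mult \<Gamma> p \<le> port_card D p" "matching_factor D \<Gamma> p = of_nat (card G)"
    "card G \<le> (\<Prod>q\<in>support \<Gamma>. port_card D q choose mult \<Gamma> q)"
proof -
  note card = instances_card[OF \<Gamma>]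
  have a: "finite (support \<Gamma>)" and pos: "mult \<Gamma> p > 0" "deg \<Gamma> p > 0"
    using simple \<Gamma> p by (auto simp: simple_diagram_def)
  have dis: "disjoint_family_on I (support \<Gamma>)"
    using disjoint_instances by (auto simp: disjoint_family_on_def)
  have sub: "G \<subseteq> connectors (support \<Gamma>) I (mult \<Gamma>)"
    and degree: "\<forall>x\<in>I p. card {k \<in> G. x \<in> k} = deg \<Gamma> p"
    using G p by (auto simp: realises_motif_iff_connectors)
  have finF: "finite (connectors (support \<Gamma>) I (mult \<Gamma>))"
    using a card by (intro finite_connectors) auto
  have "card G \<le> card (connectors (support \<Gamma>) I (mult \<Gamma>))" using sub finF by (intro card_mono)
  also have "\<dots> = (\<Prod>q\<in>support \<Gamma>. port_card D q choose mult \<Gamma> q)"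
    using a card dis by (subst card_connectors) auto
  finally show "card G \<le> (\<Prod>q\<in>support \<Gamma>. port_card D q choose mult \<Gamma> q)" .
  have "(\<Sum>x\<in>I p. deg \<Gamma> p) = card G * mult \<Gamma> p"
    using sum_degrees_connectors[OF finite_subset[OF sub finF] sub p] card p degree by simp
  then have eq: "port_card D p * deg \<Gamma> p = card G * mult \<Gamma> p" using card p by simp
  show "matching_factor D \<Gamma> p = of_nat (card G)"
    using pos eq by (simp add: matching_factor_def field_simps flip: of_nat_mult)
  \<comment> \<open>A positive number of incidences yields a connector, and its \<open>m_p\<close>
    instances of \<open>p\<close> are found among the \<open>n_p\<close> available ones.\<close>
  have "G \<noteq> {}" using eq card(2)[OF p] pos by auto
  then obtain k where "k \<in> G" by blast
  then have "mult \<Gamma> p = card (k \<inter> I p)" using G p by (auto simp: realises_motif_def)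
  then show "mult \<Gamma> p \<le> port_card D p"
    using card[OF p] card_mono[of "I p" "k \<inter> I p"] by simp
qed

text \<open>The common value of the matching factors is the size \<open>s\<close> of the regular
  family; clearing the denominator \<open>m_p\<close> turns its definition into the required degree
  balance.\<close>

lemma ex_realises_motif:
  assumes \<Gamma>: "\<Gamma> \<in> motifs D"
    and s: "\<forall>p\<in>support \<Gamma>. \<forall>q\<in>support \<Gamma>.
      matching_factor D \<Gamma> p = matching_factor D \<Gamma> q \<and> matching_factor D \<Gamma> q \<in> \<nat>"
    and le: "\<forall>p\<in>support \<Gamma>.
      matching_factor D \<Gamma> p \<le> of_nat (\<Prod>q\<in>support \<Gamma>. port_card D q choose mult \<Gamma> q)"
  shows "\<exists>G. realises_motif \<Gamma> I G"
proof -
  note card = instances_card[OF \<Gamma>]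
  have a: "finite (support \<Gamma>)" "support \<Gamma> \<noteq> {}" and pos: "\<And>p. p \<in> support \<Gamma> \<Longrightarrow> mult \<Gamma> p > 0"
    using simple \<Gamma> by (auto simp: simple_diagram_def)
  have dis: "disjoint_family_on I (support \<Gamma>)"
    using disjoint_instances by (auto simp: disjoint_family_on_def)
  obtain q where q: "q \<in> support \<Gamma>" using a by blast
  then obtain n where "matching_factor D \<Gamma> q = of_nat n" using s by (meson Nats_cases)
  then have n: "matching_factor D \<Gamma> p = of_nat n" if "p \<in> support \<Gamma>" for p
    using s q that by metis
  have "n * mult \<Gamma> p = card (I p) * deg \<Gamma> p" if p: "p \<in> support \<Gamma>" for p
  proof -
    have "(of_nat (n * mult \<Gamma> p) :: rat) = of_nat (card (I p) * deg \<Gamma> p)"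
      using n[OF p] pos[OF p] card[OF p] by (simp add: matching_factor_def field_simps)
    then show ?thesis by (simp only: of_nat_eq_iff)
  qed
  moreover have "n \<le> (\<Prod>p\<in>support \<Gamma>. card (I p) choose mult \<Gamma> p)"
  proof -
    have "(of_nat n :: rat) \<le> of_nat (\<Prod>p\<in>support \<Gamma>. port_card D p choose mult \<Gamma> p)"
      using le q n by metis
    then show ?thesis using card by (simp only: of_nat_le_iff) simp
  qed
  ultimately show ?thesis
    using ex_regular_connectors[OF a(1) _ dis, of n "mult \<Gamma>" "deg \<Gamma>"] card
    by (auto simp: realises_motif_iff_connectors)
qed

text \<open>Since multiplicities are positive and instance sets disjoint, the support is read off
  from \<open>k\<close> as the set of ports \<open>p\<close> whose instances it meets, and the
  multiplicities as the sizes of these traces. The standing assumption on motifs with equal support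
  then identifies the two.\<close>

lemma realised_motif_unique:
  assumes "\<Gamma> \<in> motifs D" "\<Delta> \<in> motifs D"
    and "realises_motif \<Gamma> I G" "realises_motif \<Delta> I H" "k \<in> G" "k \<in> H"
  shows "\<Gamma> = \<Delta>"
proof -
  have mult: "card (k \<inter> I p) = mult \<Lambda> p" if "realises_motif \<Lambda> I E" "k \<in> E" "p \<in> support \<Lambda>" for \<Lambda> E p
    using that by (simp add: realises_motif_def)
  have supp: "support \<Lambda> = {p. k \<inter> I p \<noteq> {}}"
    if "\<Lambda> \<in> motifs D" "realises_motif \<Lambda> I E" "k \<in> E" for \<Lambda> E
  proof (intro equalityI subsetI)
    fix p assume p: "p \<in> support \<Lambda>"
    then have "card (k \<inter> I p) = mult \<Lambda> p" using mult that by blast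
    moreover have "mult \<Lambda> p > 0" using p that(1) simple by (simp add: simple_diagram_def)
    ultimately show "p \<in> {p. k \<inter> I p \<noteq> {}}" by force
  next
    fix p assume "p \<in> {p. k \<inter> I p \<noteq> {}}"
    then obtain x where x: "x \<in> k" "x \<in> I p" by blast
    have "k \<subseteq> (\<Union>q\<in>support \<Lambda>. I q)" using that by (simp add: realises_motif_def)
    then obtain q where "q \<in> support \<Lambda>" "x \<in> I q" using x by blast
    then show "p \<in> support \<Lambda>" using disjoint_instances[of p q] x by blast
  qed
  have supp_eq: "support \<Gamma> = support \<Delta>"
    using supp[OF assms(1,3,5)] supp[OF assms(2,4,6)] by simp
  have "mult \<Gamma> p = mult \<Delta> p" if "p \<in> support \<Gamma>" for p
  proof -
    have "card (k \<inter> I p) = mult \<Gamma> p" "card (k \<inter> I p) = mult \<Delta> p"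
      using mult[OF assms(3,5)] mult[OF assms(4,6)] supp_eq that by simp_all
    then show ?thesis by simp
  qed
  then show ?thesis using supp_eq assms(1,2) simple unfolding simple_diagram_def by blast
qed

end

section \<open>Building the components of a diagram\<close>

lemma ex_typed_architecture:
  fixes D :: "('t, 'p) diagram" and f :: "'p \<times> nat \<Rightarrow> 'q"
  assumes D: "simple_diagram D" and C: "infinite (UNIV :: 'c set)" and f: "inj f"
  shows "\<exists>(C :: 'c set) P ty inst. \<forall>\<gamma>.
    typed_architecture D \<lparr>comps = C, ports = P, config = \<gamma>\<rparr> ty (inst :: 'c \<Rightarrow> 'p \<Rightarrow> 'q)"
proof -
  let ?K = "SIGMA t:types D. {..<cardinality D t}"
  have "finite ?K" using D by (auto simp: simple_diagram_def)
  obtain C :: "'c set" where C: "finite C" "card C = card ?K"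
    using infinite_arbitrarily_large[OF C] by blast
  \<comment> \<open>\<open>e\<close> labels each component with its type and a copy number; the port
    for \<open>p\<close> in copy \<open>i\<close> will be \<open>f (p, i)\<close>.\<close>
  obtain e where e: "bij_betw e C ?K"
    using finite_same_card_bij[OF C(1) \<open>finite ?K\<close> C(2)] by blast
  define P where "P c = f ` (gports D (fst (e c)) \<times> {snd (e c)})" for c
  define ty where "ty c = Some (fst (e c))" for c
  define inst where "inst c p = f (p, snd (e c))" for c p
  have "typed_architecture D \<lparr>comps = C, ports = P, config = \<gamma>\<rparr> ty inst" (is "typed_architecture D ?A _ _") for \<gamma>
  proof
    show "simple_diagram D" by fact
    show "disjoint_family_on (ports ?A) (comps ?A)"
      unfolding disjoint_family_on_def
    proof (intro ballI impI)
      fix c c' assume c: "c \<in> comps ?A" "c' \<in> comps ?A" "c \<noteq> c'"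
      then have "e c \<noteq> e c'" using e by (auto simp: bij_betw_def dest: inj_onD)
      moreover have "fst (e c) \<in> types D" "fst (e c') \<in> types D"
        using c bij_betwE[OF e] by fastforce+
      \<comment> \<open>Distinct components differ in copy number or in type, and distinct types
        share no generic port; injectivity of \<open>f\<close> carries this over to the
        ports.\<close>
      ultimately have "snd (e c) \<noteq> snd (e c') \<or> gports D (fst (e c)) \<inter> gports D (fst (e c')) = {}"
        using D by (auto simp: simple_diagram_def disjoint_family_on_def prod_eq_iff)
      then show "ports ?A c \<inter> ports ?A c' = {}"
        by (auto simp: P_def dest!: injD[OF f])
    qed
    show "typing D ?A ty inst"
      unfolding typing_def
    proof (intro ballI)
      fix t c assume "c \<in> comps_of_type ?A ty t"
      then have "fst (e c) = t" by (simp add: comps_of_type_def ty_def)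
      then show "bij_betw (inst c) (gports D t) (ports ?A c)"
        by (auto simp: bij_betw_def inst_def P_def inj_on_def dest!: injD[OF f])
    qed
    show "\<forall>t\<in>types D. card (comps_of_type ?A ty t) = cardinality D t"
    proof
      fix t assume t: "t \<in> types D"
      have "e ` comps_of_type ?A ty t = {t} \<times> {..<cardinality D t}"
      proof (intro equalityI subsetI)
        fix v assume "v \<in> e ` comps_of_type ?A ty t"
        then have "v \<in> ?K" "fst v = t" using bij_betwE[OF e]
          by (auto simp: comps_of_type_def ty_def)
        then show "v \<in> {t} \<times> {..<cardinality D t}" by auto
      next
        fix v assume "v \<in> {t} \<times> {..<cardinality D t}"
        then obtain i where i: "v = (t, i)" "i < cardinality D t" by blast
        then have "v \<in> e ` C" using t e by (simp add: bij_betw_def)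
        then obtain c where c: "c \<in> C" "e c = (t, i)" using i by (metis imageE)
        then have "c \<in> comps_of_type ?A ty t" by (simp add: comps_of_type_def ty_def)
        then show "v \<in> e ` comps_of_type ?A ty t" using c i by (metis imageI)
      qed
      moreover have "inj_on e (comps_of_type ?A ty t)"
        using e by (auto simp: bij_betw_def comps_of_type_def intro: inj_on_subset)
      ultimately show "card (comps_of_type ?A ty t) = cardinality D t"
        using card_image by fastforce
    qed
  qed
  then show ?thesis by blast
qed

text \<open>Components and ports are values of the fixed types \<open>'c\<close> and
  \<open>'q\<close>. The infinite \<open>'c\<close> and the injection into \<open>'q\<close> supply
  as many of them as the diagram may demand.\<close>

theorem proposition2p2:
  fixes D :: "('t, 'p) diagram"
  assumes "simple_diagram D"
    and "infinite (UNIV :: 'c set)"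
    and "\<exists>f :: 'p \<times> nat \<Rightarrow> 'q. inj f"
  shows "(\<exists>A :: ('c, 'q) architecture. wf_architecture A \<and> conforms A D) \<longleftrightarrow>
    (\<forall>\<Gamma>\<in>motifs D. \<forall>p\<in>support \<Gamma>.
       mult \<Gamma> p \<le> port_card D p \<and>
       (\<forall>q\<in>support \<Gamma>. matching_factor D \<Gamma> p = matching_factor D \<Gamma> q \<and>
          matching_factor D \<Gamma> q \<in> \<nat>) \<and>
       matching_factor D \<Gamma> p \<le> of_nat (\<Prod>q\<in>support \<Gamma>. port_card D q choose mult \<Gamma> q))"
    (is "?L \<longleftrightarrow> ?R")
proof
  assume ?L
  then obtain A :: "('c, 'q) architecture" and ty inst part where A: "wf_architecture A"
    "typing D A ty inst" "\<forall>t\<in>types D. card (comps_of_type A ty t) = cardinality D t"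
    and part: "\<forall>\<Gamma>\<in>motifs D. realises_motif \<Gamma> (instances D A ty inst) (part \<Gamma>)"
    unfolding conforms_def by blast
  interpret typed_architecture D A ty inst
    using assms A by unfold_locales (auto simp: wf_architecture_def)
  show ?R
  proof (intro ballI)
    fix \<Gamma> p assume \<Gamma>: "\<Gamma> \<in> motifs D" and p: "p \<in> support \<Gamma>"
    note cond = realises_motif_conditions[OF \<Gamma> bspec[OF part \<Gamma>]]
    show "mult \<Gamma> p \<le> port_card D p \<and>
       (\<forall>q\<in>support \<Gamma>. matching_factor D \<Gamma> p = matching_factor D \<Gamma> q \<and>
          matching_factor D \<Gamma> q \<in> \<nat>) \<and>
       matching_factor D \<Gamma> p \<le> of_nat (\<Prod>q\<in>support \<Gamma>. port_card D q choose mult \<Gamma> q)"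
      \<comment> \<open>All matching factors of the motif equal the single number
        \<open>card (part \<Gamma>)\<close>.\<close>
      using cond(1,3)[OF p] cond(2) p by (simp del: of_nat_prod)
  qed
next
  assume R: ?R
  obtain f :: "'p \<times> nat \<Rightarrow> 'q" where f: "inj f" using assms(3) by blast
  obtain C :: "'c set" and P ty and inst :: "'c \<Rightarrow> 'p \<Rightarrow> 'q" where typed:
    "\<And>\<gamma>. typed_architecture D \<lparr>comps = C, ports = P, config = \<gamma>\<rparr> ty inst"
    using ex_typed_architecture[OF assms(1,2) f] by blast
  \<comment> \<open>The connectors are chosen before the configuration is known, so the instances
    are taken with an empty one; they depend only on the components and their typing, whence
    \<open>J = I\<close> later.\<close>
  define J where "J = instances D \<lparr>comps = C, ports = P, config = {}\<rparr> ty inst"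
  have "\<forall>\<Gamma>\<in>motifs D. \<exists>G. realises_motif \<Gamma> J G"
    using typed_architecture.ex_realises_motif[OF typed[of "{}"]] R unfolding J_def by blast
  then obtain part where part: "\<forall>\<Gamma>\<in>motifs D. realises_motif \<Gamma> J (part \<Gamma>)" by metis
  let ?A = "\<lparr>comps = C, ports = P, config = \<Union>\<Gamma>\<in>motifs D. part \<Gamma>\<rparr>"
  interpret typed_architecture D ?A ty inst by (rule typed)
  have J: "J = I" by (auto simp: J_def instances_def comps_of_type_def fun_eq_iff)
  \<comment> \<open>A connector in the parts of two motifs would determine both of them, so the
    motifs coincide.\<close>
  have "disjoint_family_on part (motifs D)"
    using realised_motif_unique part unfolding J disjoint_family_on_def by blast
  then have "conforms ?A D"
    unfolding conforms_def using typing card_comps part[unfolded J]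
    by (intro exI[of _ ty] exI[of _ inst] conjI exI[of _ part]) simp_all
  moreover have "wf_architecture ?A"
    unfolding wf_architecture_def
  proof (intro conjI ballI disjoint_ports)
    fix k assume "k \<in> config ?A"
    then obtain \<Gamma> where "\<Gamma> \<in> motifs D" "k \<in> part \<Gamma>" by auto
    then have "k \<subseteq> (\<Union>p\<in>support \<Gamma>. I p)" using part by (simp add: J realises_motif_def)
    then show "k \<subseteq> (\<Union>c\<in>comps ?A. ports ?A c)" using instances_subset_ports by blast
  qed
  ultimately show ?L by blast
qed

end
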